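(* Let $N,L,H,d_x,V\ge1$ be integers with $H\mid d_x$ and assume $L>\log_3 d_x$. Let $S_1,S_2$ be two sentences of length $N$ over the vocabulary $[V]$, let $p\in[d_x]$ and $i\in[2N]$, and let $y^{(p,i),L,d_x}_{\mathrm{in\text{-}context}}$ be the $p$-th entry of the in-context representation of $(S_1,S_2)$ at location $i$ (defined in the context). Then $$\log\Big[\mathrm{seq}\text{-}\mathrm{sep}\big(y^{(p,i),L,d_x}_{\mathrm{in\text{-}context}}\big)\Big]=\tilde O(L\cdot d_x).$$
   Context: Notation: $[n]=\{1,\dots,n\}$; $\odot$ is the entrywise product; $\tilde O$ omits the log terms $\log d_x,\log L,\log H$. Network. Let $d_a=d_x/H$. The network weights are $\mathcal W=\{W^{\mathrm K,l,h},W^{\mathrm Q,l,h},W^{\mathrm V,l,h},(W^{\mathrm O,l,h})^\top\in\mathbb R^{d_a\times d_x}: l\in[L],h\in[H]\}$ and a vocabulary embedding matrix $M^{\mathrm V}\in\mathbb R^{d_x\times V}$; $E_{M^{\mathrm V}}(w)$ denotes its $w$-th column. For input vectors $\mathbf x^1,\dots,\mathbf x^n\in\mathbb R^{d_x}$ define $\mathbf g^{i,0}_{\mathcal W}=\mathbf x^i$ and, for $l=1,\dots,L$, $$\mathbf g^{i,l}_{\mathcal W}=\sum_{h=1}^H W^{\mathrm O,l,h}\sum_{j=1}^{n}\big\langle W^{\mathrm Q,l,h}\mathbf g^{i,l-1}_{\mathcal W},W^{\mathrm K,l,h}\mathbf g^{j,l-1}_{\mathcal W}\big\rangle W^{\mathrm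 V,l,h}\mathbf g^{j,l-1}_{\mathcal W}.$$ Write $\mathbf g^{i,L}_{\mathcal W}(\mathbf x^1,\dots,\mathbf x^n)\in\mathbb R^{d_x}$ for the output at location $i$. In-context representation. For $S_1=(w_1^1,\dots,w_1^N)$ and $S_2=(w_2^1,\dots,w_2^N)$, the in-context representation at location $i\in[2N]$ is $\mathbf g^{i,L}_{\mathcal W}\big(E_{M^{\mathrm V}}(w_1^1),\dots,E_{M^{\mathrm V}}(w_1^N),E_{M^{\mathrm V}}(w_2^1),\dots,E_{M^{\mathrm V}}(w_2^N)\big)$. With sentence-association variables $\mathbf a,\mathbf b\in\mathbb R^{d_x}$, put $$\mathcal Z(\mathbf a,\mathbf b)=\Big[\mathbf g^{i,L}_{\mathcal W}\big(E_{M^{\mathrm V}}(w_1^1)\odot\mathbf a,\dots,E_{M^{\mathrm V}}(w_1^N)\odot\mathbf a,\,E_{M^{\mathrm V}}(w_2^1)\odot\mathbf b,\dots,E_{M^{\mathrm V}}(w_2^N)\odot\mathbf b\big)\Big]_p .$$ Separation rank. For a real function $y(A,B)$, $\mathrm{sep}_{(A,B)}(y)$ is the minimal $R$ such that $y(A,B)=\sum_{r=1}^R g_r(A)g'_r(B)$ for some real functions $g_r,g'_r$. Finally $\mathrm{seq}\text{-}\mathrm{sep}(y_{\mathrm{in\text{-}context}}):=\mathrm{sep}_{(\mathbf a,\mathbf b)}(\mathcal Z)$. *)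

theory Defs
  imports Complex_Main "HOL-Library.Extended_Nat" "Jordan_Normal_Form.Matrix"
begin

text \<open>All index sets \<open>[n]\<close> are rendered as \<open>{..<n}\<close>, matching the 0-based indexing of lists, vectors and
  matrices in the libraries. The weights of layer \<open>l + 1\<close> and head \<open>h + 1\<close> are thus \<open>WK W l h\<close> etc.\<close>

record attn_weights =
  WK :: "nat \<Rightarrow> nat \<Rightarrow> real mat"
  WQ :: "nat \<Rightarrow> nat \<Rightarrow> real mat"
  WV :: "nat \<Rightarrow> nat \<Rightarrow> real mat"
  WO :: "nat \<Rightarrow> nat \<Rightarrow> real mat"

definition valid_weights :: "nat \<Rightarrow> nat \<Rightarrow> nat \<Rightarrow> attn_weights \<Rightarrow> bool" where
  "valid_weights L H d W \<longleftrightarrow> (\<forall>l<L. \<forall>h<H.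
     WK W l h \<in> carrier_mat (d div H) d \<and>
     WQ W l h \<in> carrier_mat (d div H) d \<and>
     WV W l h \<in> carrier_mat (d div H) d \<and>
     WO W l h \<in> carrier_mat d (d div H))"

primrec attn_output :: "nat \<Rightarrow> nat \<Rightarrow> attn_weights \<Rightarrow> real vec list \<Rightarrow> nat \<Rightarrow> nat \<Rightarrow> real vec" where
  "attn_output H d W xs 0 = (\<lambda>i. xs ! i)"
| "attn_output H d W xs (Suc l) = (\<lambda>i.
     let g = attn_output H d W xs l in
     finsum_vec TYPE(real) d
       (\<lambda>h. WO W l h *\<^sub>v
          finsum_vec TYPE(real) (d div H)
            (\<lambda>j. ((WQ W l h *\<^sub>v g i) \<bullet> (WK W l h *\<^sub>v g j)) \<cdot>\<^sub>v (WV W l h *\<^sub>v g j))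
            {..<length xs})
       {..<H})"

text \<open>The \<open>p\<close>-th entry of the in-context representation at location \<open>i\<close>, as a function of the two
  sequences of vectors that represent the two sentences. For sentences \<open>S\<^sub>1\<close> and \<open>S\<^sub>2\<close> these are
  \<open>map (col M) S\<^sub>1\<close> and \<open>map (col M) S\<^sub>2\<close>, where \<open>M\<close> is the vocabulary embedding matrix.\<close>

definition y_in_context ::
  "nat \<Rightarrow> nat \<Rightarrow> nat \<Rightarrow> attn_weights \<Rightarrow> nat \<Rightarrow> nat \<Rightarrow> real vec list \<Rightarrow> real vec list \<Rightarrow> real" where
  "y_in_context L H d W p i us vs = attn_output H d W (us @ vs) L i $ p"

definition sep_rank :: "'a set \<Rightarrow> 'b set \<Rightarrow> ('a \<Rightarrow> 'b \<Rightarrow> real) \<Rightarrow> enat" where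
  "sep_rank A B y = Inf {enat R | R. \<exists>g g'. \<forall>a\<in>A. \<forall>b\<in>B. y a b = (\<Sum>r<R. g r a * g' r b)}"

definition entrywise_prod :: "real vec \<Rightarrow> real vec \<Rightarrow> real vec" where
  "entrywise_prod u v = vec (dim_vec u) (\<lambda>r. u $ r * v $ r)"

definition seq_sep ::
  "nat \<Rightarrow> real mat \<Rightarrow> nat list \<Rightarrow> nat list \<Rightarrow> (real vec list \<Rightarrow> real vec list \<Rightarrow> real) \<Rightarrow> enat" where
  "seq_sep d M S1 S2 y = sep_rank (carrier_vec d) (carrier_vec d)
     (\<lambda>a b. y (map (\<lambda>w. entrywise_prod (col M w) a) S1) (map (\<lambda>w. entrywise_prod (col M w) b) S2))"

end

theory Submission
  imports Defs "HOL-Library.FuncSet"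
begin

text \<open>Every layer of the network is cubic in the output of the previous one, so after \<open>L\<close> layers each
  output entry is a polynomial of degree at most \<open>3 ^ L\<close> in every coordinate of \<open>a\<close>, with coefficients
  depending on \<open>b\<close>. Expanding in monomials of \<open>a\<close> bounds the separation rank by \<open>(3 ^ L + 1) ^ d\<close>, whose
  logarithm is already \<open>O(L * d)\<close>.\<close>

text \<open>Here \<open>m\<close> bounds the exponent of each entry of \<open>a\<close> separately,
  not the total degree, so that the monomials are counted by a plain power. Coefficients may be
  arbitrary functions of \<open>b\<close>, because separation rank imposes no condition on the
  factors.\<close>

inductive sep_poly :: "nat \<Rightarrow> nat \<Rightarrow> (real vec \<Rightarrow> 'b \<Rightarrow> real) \<Rightarrow> bool" for d m where
  monomial: "(\<And>r. r < d \<Longrightarrow> e r \<le> m) \<Longrightarrow> sep_poly d m (\<lambda>a b. (\<Prod>r<d. a $ r ^ e r) * c b)"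
| add: "sep_poly d m f \<Longrightarrow> sep_poly d m g \<Longrightarrow> sep_poly d m (\<lambda>a b. f a b + g a b)"

section \<open>Closure properties of polynomials in \<open>a\<close> with coefficients in
  \<open>b\<close>\<close>

lemma sep_poly_fun_right: "sep_poly d m (\<lambda>a b. c b)"
  using sep_poly.monomial[of d "\<lambda>_. 0" m c] by simp

lemma sep_poly_coordinate:
  assumes "r < d" "1 \<le> m"
  shows "sep_poly d m (\<lambda>a b. a $ r)"
proof -
  have "(\<Prod>s<d. a $ s ^ (if s = r then 1 else 0)) = a $ r" for a :: "real vec"
  proof -
    have "(\<Prod>s<d. a $ s ^ (if s = r then 1 else 0)) = (\<Prod>s<d. if s = r then a $ s else 1)"
      by (intro prod.cong) auto
    then show ?thesis
      using assms(1) by simp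
  qed
  moreover have "sep_poly d m (\<lambda>a b. (\<Prod>s<d. a $ s ^ (if s = r then 1 else 0)) * 1)"
    using assms(2) by (intro sep_poly.monomial) auto
  ultimately show ?thesis
    by simp
qed

lemma sep_poly_sum:
  assumes "\<And>j. j \<in> J \<Longrightarrow> sep_poly d m (f j)"
  shows "sep_poly d m (\<lambda>a b. \<Sum>j\<in>J. f j a b)"
  using assms
  by (induction J rule: infinite_finite_induct) (auto intro: sep_poly_fun_right sep_poly.add)

text \<open>A nested induction distributes the product over both sums; for two monomials the
  exponents add in each coordinate and the coefficients in \<open>b\<close> multiply.\<close>

lemma sep_poly_mult:
  assumes "sep_poly d m f" "sep_poly d n g"
  shows "sep_poly d (m + n) (\<lambda>a b. f a b * g a b)"
  using assms(1)
proof induction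
  case (monomial e c)
  note e = this
  show ?case
    using assms(2)
  proof induction
    case (monomial e' c')
    have "sep_poly d (m + n) (\<lambda>a b. (\<Prod>r<d. a $ r ^ (e r + e' r)) * (c b * c' b))"
      using e monomial by (intro sep_poly.monomial) (auto intro: add_mono)
    then show ?case
      by (simp add: power_add prod.distrib mult_ac)
  next
    case (add g1 g2)
    then show ?case
      by (simp add: distrib_left sep_poly.add)
  qed
next
  case (add f1 f2)
  then show ?case
    by (simp add: distrib_right sep_poly.add)
qed

lemma sep_poly_cmult:
  assumes "sep_poly d m f"
  shows "sep_poly d m (\<lambda>a b. c * f a b)"
  \<comment> \<open>A constant has degree bound 0, so the product rule leaves \<open>m\<close>
    unchanged.\<close>
  using sep_poly_mult[OF sep_poly_fun_right[of d 0 "\<lambda>_. c"] assms] by simp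

text \<open>Collecting like monomials: a derivation of \<open>sep_poly\<close> may add up any number
  of terms, but there are only finitely many exponent vectors. Extensional functions represent each
  of them exactly once.\<close>

lemma sep_poly_monomial_expansion:
  assumes "sep_poly d m f"
  shows "\<exists>c. \<forall>a b. f a b = (\<Sum>e \<in> {..<d} \<rightarrow>\<^sub>E {..m}. (\<Prod>r<d. a $ r ^ e r) * c e b)"
  using assms
proof induction
  case (monomial e c)
  \<comment> \<open>Values of \<open>e\<close> outside \<open>{..<d}\<close> are arbitrary;
    restricting makes the function extensional and leaves the product unchanged.\<close>
  define e' where "e' = restrict e {..<d}"
  have e': "e' \<in> {..<d} \<rightarrow>\<^sub>E {..m}"
    using monomial by (auto simp: e'_def)
  have fin: "finite ({..<d} \<rightarrow>\<^sub>E {..m})"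
    by (simp add: finite_PiE)
  have "(\<Prod>r<d. a $ r ^ e r) * c b =
      (\<Sum>k \<in> {..<d} \<rightarrow>\<^sub>E {..m}. (\<Prod>r<d. a $ r ^ k r) * (if k = e' then c b else 0))" for a b
  proof -
    have "(\<Sum>k \<in> {..<d} \<rightarrow>\<^sub>E {..m}. (\<Prod>r<d. a $ r ^ k r) * (if k = e' then c b else 0)) =
        (\<Sum>k \<in> {..<d} \<rightarrow>\<^sub>E {..m}. if k = e' then (\<Prod>r<d. a $ r ^ k r) * c b else 0)"
      by (intro sum.cong) auto
    also have "\<dots> = (\<Prod>r<d. a $ r ^ e' r) * c b"
      using e' fin by (simp add: sum.delta)
    also have "\<dots> = (\<Prod>r<d. a $ r ^ e r) * c b"
      by (simp add: e'_def)
    finally show ?thesis by simp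
  qed
  then show ?case
    by (intro exI[of _ "\<lambda>k b. if k = e' then c b else 0"]) blast
next
  case (add f g)
  then obtain c c' where
    "\<forall>a b. f a b = (\<Sum>e \<in> {..<d} \<rightarrow>\<^sub>E {..m}. (\<Prod>r<d. a $ r ^ e r) * c e b)"
    "\<forall>a b. g a b = (\<Sum>e \<in> {..<d} \<rightarrow>\<^sub>E {..m}. (\<Prod>r<d. a $ r ^ e r) * c' e b)"
    by blast
  then show ?case
    by (intro exI[of _ "\<lambda>e b. c e b + c' e b"]) (simp add: distrib_left sum.distrib)
qed

section \<open>From monomial expansions to separation rank\<close>

lemma sep_rank_le:
  assumes "finite I" "\<And>a b. a \<in> A \<Longrightarrow> b \<in> B \<Longrightarrow> y a b = (\<Sum>e\<in>I. g e a * g' e b)"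
  shows "sep_rank A B y \<le> enat (card I)"
proof -
  \<comment> \<open>The definition of \<open>sep_rank\<close> sums over an initial segment of the
    naturals, so the index set is enumerated by a bijection.\<close>
  obtain h where h: "bij_betw h {..<card I} I"
    using ex_bij_betw_nat_finite[OF assms(1)] by (auto simp: atLeast0LessThan)
  have "\<forall>a\<in>A. \<forall>b\<in>B. y a b = (\<Sum>r<card I. g (h r) a * g' (h r) b)"
    using sum.reindex_bij_betw[OF h, of "\<lambda>e. g e _ * g' e _"] assms(2) by simp
  then show ?thesis
    unfolding sep_rank_def
    by (intro Inf_lower CollectI exI[of _ "card I"] conjI refl exI[of _ "\<lambda>r. g (h r)"]
        exI[of _ "\<lambda>r. g' (h r)"])
qed

text \<open>Each exponent vector gives one separated summand, a monomial in \<open>a\<close> times a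
  coefficient in \<open>b\<close>, and there are \<open>m + 1\<close> choices of exponent for each
  of the \<open>d\<close> coordinates.\<close>

lemma sep_rank_sep_poly:
  assumes "sep_poly d m y"
  shows "sep_rank A B y \<le> enat ((m + 1) ^ d)"
proof -
  obtain c where
    "\<forall>a b. y a b = (\<Sum>e \<in> {..<d} \<rightarrow>\<^sub>E {..m}. (\<Prod>r<d. a $ r ^ e r) * c e b)"
    using sep_poly_monomial_expansion[OF assms] by blast
  then have "sep_rank A B y \<le> enat (card ({..<d} \<rightarrow>\<^sub>E {..m}))"
    by (intro sep_rank_le) (auto intro: finite_PiE)
  then show ?thesis
    by (simp add: card_PiE)
qed

section \<open>Vectors with polynomial entries\<close>

text \<open>The dimension \<open>n\<close> is kept apart from the number \<open>d\<close> of
  variables, since queries, keys and values live in dimension \<open>d div H\<close>. Fixing the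
  dimension for all \<open>a\<close> and \<open>b\<close> lets entries of products and sums be
  computed.\<close>

definition sep_poly_vec :: "nat \<Rightarrow> nat \<Rightarrow> nat \<Rightarrow> (real vec \<Rightarrow> 'b \<Rightarrow> real vec) \<Rightarrow> bool" where
  "sep_poly_vec d n m v \<longleftrightarrow>
    (\<forall>a b. v a b \<in> carrier_vec n) \<and> (\<forall>r<n. sep_poly d m (\<lambda>a b. v a b $ r))"

lemma sep_poly_vec_dim: "sep_poly_vec d n m v \<Longrightarrow> dim_vec (v a b) = n"
  by (metis sep_poly_vec_def carrier_vecD)

lemma sep_poly_scalar_prod:
  assumes "sep_poly_vec d n m v" "sep_poly_vec d n m' w"
  shows "sep_poly d (m + m') (\<lambda>a b. v a b \<bullet> w a b)"
proof -
  have "v a b \<bullet> w a b = (\<Sum>r = 0..<n. v a b $ r * w a b $ r)" for a b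
    using sep_poly_vec_dim[OF assms(2)] by (simp add: scalar_prod_def)
  then show ?thesis
    using assms by (auto simp: sep_poly_vec_def intro!: sep_poly_sum sep_poly_mult)
qed

lemma sep_poly_vec_mult_mat:
  assumes "A \<in> carrier_mat k n" "sep_poly_vec d n m v"
  shows "sep_poly_vec d k m (\<lambda>a b. A *\<^sub>v v a b)"
proof -
  have "(A *\<^sub>v v a b) $ r = (\<Sum>s = 0..<n. A $$ (r, s) * v a b $ s)" if "r < k" for a b r
    using assms(1) that sep_poly_vec_dim[OF assms(2)] by (simp add: scalar_prod_def)
  then show ?thesis
    using assms by (auto simp: sep_poly_vec_def intro!: sep_poly_sum sep_poly_cmult)
qed

lemma sep_poly_vec_smult:
  assumes "sep_poly d m f" "sep_poly_vec d n m' v"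
  shows "sep_poly_vec d n (m + m') (\<lambda>a b. f a b \<cdot>\<^sub>v v a b)"
proof -
  have "(f a b \<cdot>\<^sub>v v a b) $ r = f a b * v a b $ r" if "r < n" for a b r
    using sep_poly_vec_dim[OF assms(2)] that by simp
  then show ?thesis
    using assms by (auto simp: sep_poly_vec_def intro!: sep_poly_mult)
qed

lemma sep_poly_vec_finsum:
  assumes "finite J" "\<And>j. j \<in> J \<Longrightarrow> sep_poly_vec d n m (v j)"
  shows "sep_poly_vec d n m (\<lambda>a b. finsum_vec TYPE(real) n (\<lambda>j. v j a b) J)"
proof -
  have car: "(\<lambda>j. v j a b) \<in> J \<rightarrow> carrier_vec n" for a b
    using assms(2) by (auto simp: sep_poly_vec_def)
  have "finsum_vec TYPE(real) n (\<lambda>j. v j a b) J $ r = (\<Sum>j\<in>J. v j a b $ r)" if "r < n" for a b r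
    by (rule index_finsum_vec[OF assms(1) that car])
  then show ?thesis
    using assms(2) car by (auto simp: sep_poly_vec_def intro!: sep_poly_sum finsum_vec_closed)
qed

section \<open>Degree growth through the layers\<close>

lemma sep_poly_vec_attn_output:
  assumes "valid_weights L H n W"
    and inputs: "\<And>j. j < k \<Longrightarrow> sep_poly_vec d n 1 (\<lambda>a b. xs a b ! j)"
    and len: "\<And>a b. length (xs a b) = k"
    and "l \<le> L" "i < k"
  shows "sep_poly_vec d n (3 ^ l) (\<lambda>a b. attn_output H n W (xs a b) l i)"
  using assms(4,5)
\<comment> \<open>The location is generalized because each location attends to all locations of the
  layer below.\<close>
proof (induction l arbitrary: i)
  case 0
  then show ?case
    using inputs by simp
next
  case (Suc l)
  define g where "g j a b = attn_output H n W (xs a b) l j" for j a b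
  have g: "sep_poly_vec d n (3 ^ l) (g j)" if "j < k" for j
    using Suc.IH[of j] Suc.prems that by (simp add: g_def[abs_def])
  have carrier: "WK W l h \<in> carrier_mat (n div H) n" "WQ W l h \<in> carrier_mat (n div H) n"
    "WV W l h \<in> carrier_mat (n div H) n" "WO W l h \<in> carrier_mat n (n div H)" if "h < H" for h
    using assms(1) Suc.prems that by (auto simp: valid_weights_def)
  \<comment> \<open>The three summands of the degree come from query, key and value; the weight
    matrices and the sums over locations and heads do not raise it.\<close>
  have "sep_poly_vec d n (3 ^ l + 3 ^ l + 3 ^ l) (\<lambda>a b. finsum_vec TYPE(real) n
       (\<lambda>h. WO W l h *\<^sub>v
          finsum_vec TYPE(real) (n div H)
            (\<lambda>j. ((WQ W l h *\<^sub>v g i a b) \<bullet> (WK W l h *\<^sub>v g j a b)) \<cdot>\<^sub>v (WV W l h *\<^sub>v g j a b))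
            {..<k})
       {..<H})"
    using Suc.prems(2)
    by (intro sep_poly_vec_finsum sep_poly_vec_mult_mat[of _ n "n div H"] sep_poly_vec_smult
        sep_poly_scalar_prod[where n = "n div H"] sep_poly_vec_mult_mat[of _ "n div H" n]
        carrier g finite_lessThan) auto
  moreover have "3 ^ l + 3 ^ l + 3 ^ l = (3 ^ Suc l :: nat)"
    by simp
  ultimately show ?case
    by (simp only: attn_output.simps g_def len Let_def)
qed

section \<open>The two sentences as network inputs\<close>

lemma entrywise_prod_closed: "u \<in> carrier_vec n \<Longrightarrow> entrywise_prod u v \<in> carrier_vec n"
  by (simp add: entrywise_prod_def carrier_vecD)

lemma sep_poly_vec_entrywise_prod_left:
  assumes "u \<in> carrier_vec d"
  shows "sep_poly_vec d d 1 (\<lambda>a b. entrywise_prod u a)"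
  using assms
  by (simp add: sep_poly_vec_def entrywise_prod_def carrier_vecD sep_poly_cmult sep_poly_coordinate)

lemma sep_poly_vec_fun_right:
  assumes "\<And>b. v b \<in> carrier_vec n"
  shows "sep_poly_vec d n m (\<lambda>a b. v b)"
  using assms by (auto simp: sep_poly_vec_def intro: sep_poly_fun_right)

lemma seq_sep_y_in_context_le:
  assumes "valid_weights L H d W" "M \<in> carrier_mat d V"
    and "p < d" "i < length S1 + length S2"
  shows "seq_sep d M S1 S2 (y_in_context L H d W p i) \<le> enat ((3 ^ L + 1) ^ d)"
proof -
  define xs where "xs a b = map (\<lambda>w. entrywise_prod (col M w) a) S1
    @ map (\<lambda>w. entrywise_prod (col M w) b) S2" for a b
  have col: "col M w \<in> carrier_vec d" for w
    using assms(2) by (metis carrier_matD(1) col_dim)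
  \<comment> \<open>Inputs from the first sentence are linear in \<open>a\<close>; those from the
    second depend on \<open>b\<close> alone and count as coefficients.\<close>
  have "sep_poly_vec d d 1 (\<lambda>a b. xs a b ! j)" if "j < length S1 + length S2" for j
  proof (cases "j < length S1")
    case True
    then show ?thesis
      using sep_poly_vec_entrywise_prod_left[OF col] by (simp add: xs_def nth_append)
  next
    case False
    have "sep_poly_vec d d 1 (\<lambda>a b. entrywise_prod (col M (S2 ! (j - length S1))) b)"
      by (intro sep_poly_vec_fun_right entrywise_prod_closed col)
    then show ?thesis
      using False that by (simp add: xs_def nth_append)
  qed
  then have "sep_poly_vec d d (3 ^ L) (\<lambda>a b. attn_output H d W (xs a b) L i)"
    using assms by (intro sep_poly_vec_attn_output[where k = "length S1 + length S2" and L = L])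
      (auto simp: xs_def)
  then have "sep_poly d (3 ^ L) (\<lambda>a b. attn_output H d W (xs a b) L i $ p)"
    using assms(3) by (simp add: sep_poly_vec_def)
  then show ?thesis
    unfolding seq_sep_def y_in_context_def xs_def by (rule sep_rank_sep_poly)
qed

section \<open>Logarithm of the monomial count and conclusion\<close>

lemma ln_monomial_count_le:
  assumes "L \<ge> 1"
  shows "ln (real ((3 ^ L + 1) ^ d)) \<le> 3 * (real L * real d)"
proof -
  \<comment> \<open>Base 4 absorbs the added 1, with equality at \<open>L = 1\<close>, where the
    induction starts.\<close>
  have "(3::real) ^ L + 1 \<le> 4 ^ L"
    using assms
  proof (induction L rule: nat_induct_at_least)
    case (Suc n)
    have "(3::real) ^ Suc n + 1 \<le> 4 * (3 ^ n + 1)"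
      by simp
    also have "\<dots> \<le> 4 * 4 ^ n"
      using Suc.IH by (rule mult_left_mono) simp
    finally show ?case
      by simp
  qed simp
  then have "ln (3 ^ L + 1 :: real) \<le> ln (4 ^ L)"
    by (intro ln_mono) (auto intro: add_pos_pos)
  also have "\<dots> = real L * ln 4"
    by (simp add: ln_realpow)
  \<comment> \<open>The constant 3 is \<open>x - 1\<close> at \<open>x = 4\<close>, from
    \<open>ln x \<le> x - 1\<close>.\<close>
  also have "\<dots> \<le> real L * 3"
    using ln_le_minus_one[of "4::real"] by (intro mult_left_mono) auto
  finally have "real d * ln (3 ^ L + 1 :: real) \<le> real d * (real L * 3)"
    by (intro mult_left_mono) auto
  then show ?thesis
    by (simp add: ln_realpow add_pos_pos ac_simps)
qed

theorem corollary1: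
  "\<exists>(C::real) (k::nat). \<forall>(N::nat) (L::nat) (H::nat) (d::nat) (V::nat) (W::attn_weights) (M::real mat)
      (S1::nat list) (S2::nat list) (p::nat) (i::nat).
    N \<ge> 1 \<and> L \<ge> 1 \<and> H \<ge> 1 \<and> d \<ge> 1 \<and> V \<ge> 1 \<and> H dvd d \<and> real L > log 3 (real d) \<and>
    valid_weights L H d W \<and> M \<in> carrier_mat d V \<and>
    length S1 = N \<and> length S2 = N \<and> set S1 \<subseteq> {..<V} \<and> set S2 \<subseteq> {..<V} \<and>
    p < d \<and> i < 2 * N \<longrightarrow>
    seq_sep d M S1 S2 (y_in_context L H d W p i) \<noteq> \<infinity> \<and>
    ln (real (the_enat (seq_sep d M S1 S2 (y_in_context L H d W p i))))
      \<le> C * (real L * real d) * ((1 + ln (real d)) * (1 + ln (real L)) * (1 + ln (real H))) ^ k"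
\<comment> \<open>\<open>C = 3\<close> is the constant of \<open>ln_monomial_count_le\<close>; that
  bound has no logarithmic factors, hence \<open>k = 0\<close>.\<close>
proof (rule exI[of _ "3::real"], rule exI[of _ "0::nat"], intro allI impI, elim conjE)
  fix N L H d V :: nat and W :: attn_weights and M :: "real mat" and S1 S2 :: "nat list"
    and p i :: nat
  assume "valid_weights L H d W" "M \<in> carrier_mat d V" "length S1 = N" "length S2 = N"
    "p < d" "i < 2 * N" and L: "L \<ge> 1"
  then have le: "seq_sep d M S1 S2 (y_in_context L H d W p i) \<le> enat ((3 ^ L + 1) ^ d)"
    by (intro seq_sep_y_in_context_le) auto
  \<comment> \<open>A bound by a finite \<open>enat\<close> already forces the rank to be
    finite.\<close>
  then obtain R where R: "seq_sep d M S1 S2 (y_in_context L H d W p i) = enat R"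
    "R \<le> (3 ^ L + 1) ^ d"
    by (cases "seq_sep d M S1 S2 (y_in_context L H d W p i)") auto
  have "ln (real R) \<le> ln (real ((3 ^ L + 1) ^ d))"
  proof (cases "R = 0")
    case False
    moreover have "real R \<le> real ((3 ^ L + 1) ^ d)"
      using R(2) by (rule of_nat_mono)
    ultimately show ?thesis
      by (intro ln_mono) auto
  next
    \<comment> \<open>Rank 0 occurs when the output vanishes identically; then
      \<open>ln 0 = 0\<close> by convention, while the right-hand side is nonnegative.\<close>
    case True
    then show ?thesis
      by (simp add: ln_realpow)
  qed
  then show "seq_sep d M S1 S2 (y_in_context L H d W p i) \<noteq> \<infinity> \<and>
    ln (real (the_enat (seq_sep d M S1 S2 (y_in_context L H d W p i))))
      \<le> 3 * (real L * real d) * ((1 + ln (real d)) * (1 + ln (real L)) * (1 + ln (real H))) ^ 0"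
    using ln_monomial_count_le[OF L, of d] R(1) by simp
qed

end
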